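(* Let $\alpha>1/2$. There is no online algorithm for the lax static case of \textsc{Knapsack} that has competitive ratio $\alpha$ and an amortized migration factor bounded by a constant $B$ (independent of the instance), when migration is measured by weight.
   Context: \textsc{Knapsack}: a capacity $C\in\mathbb N$ and items $i$ with weight $w_i\in\mathbb N$ and profit $p_i\in\mathbb N$; a subset is feasible iff its total weight is at most $C$, and its profit is the sum of its profits. Lax static case: at time $1$ an arbitrary instance $I_1$ is presented, contributing no migration potential. Afterwards, at each step one item arrives, and items never depart. The algorithm outputs a feasible $S_t$ at each time without knowledge of the future. Competitive ratio $\alpha$ means $\mathrm{profit}(S_t)\ge\alpha\,\mathrm{opt}(I_t)$ for all $t$. Migration measured by weight: the migration potential of a step is the weight of the arriving item. The migration cost of changing $S_{t-1}$ to $S_t$ is the total weight of $S_{t-1}\triangle S_t$, excluding the newly arrived item. The amortized migration factor is bounded by $B$ if for every $t$ the total migration cost up to $t$ is at most $B$ times the total migration potential up to $t$. *)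

theory Defs
  imports Complex_Main
begin

record item =
  weight :: nat
  profit :: nat

text \<open>Items are identified by their position in the list, that is, by order of arrival, so distinct
  items may share weight and profit. Subsets of the items are sets of positions.\<close>

record knapsack =
  capacity :: nat
  items :: "item list"

definition total_weight :: "knapsack \<Rightarrow> nat set \<Rightarrow> nat" where
  "total_weight I S = (\<Sum>i\<in>S. weight (items I ! i))"

definition total_profit :: "knapsack \<Rightarrow> nat set \<Rightarrow> nat" where
  "total_profit I S = (\<Sum>i\<in>S. profit (items I ! i))"

definition feasible :: "knapsack \<Rightarrow> nat set \<Rightarrow> bool" where
  "feasible I S \<longleftrightarrow> S \<subseteq> {..<length (items I)} \<and> total_weight I S \<le> capacity I"

definition opt :: "knapsack \<Rightarrow> nat" where
  "opt I = Max (total_profit I ` {S. feasible I S})"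

lemma finite_feasible: "finite {S. feasible I S}"
  by (rule finite_subset[of _ "Pow {..<length (items I)}"]) (auto simp: feasible_def)

lemma feasible_empty: "feasible I {}"
  by (simp add: feasible_def total_weight_def)

text \<open>A (deterministic) algorithm maps the initial instance and the list of items that have arrived
  so far to its current solution; this is what rules out knowledge of the future.\<close>

type_synonym algorithm = "knapsack \<Rightarrow> item list \<Rightarrow> nat set"

text \<open>Below, \<open>I\<close> is the initial instance, \<open>xs\<close> the sequence of arriving items, and \<open>k\<close> the number of
  arrivals so far, so that \<open>k\<close> arrivals correspond to time \<open>t = k + 1\<close>.\<close>

definition instance_after :: "knapsack \<Rightarrow> item list \<Rightarrow> nat \<Rightarrow> knapsack" where
  "instance_after I xs k = I\<lparr>items := items I @ take k xs\<rparr>"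

definition solution_after :: "algorithm \<Rightarrow> knapsack \<Rightarrow> item list \<Rightarrow> nat \<Rightarrow> nat set" where
  "solution_after A I xs k = A I (take k xs)"

definition online_algorithm :: "algorithm \<Rightarrow> bool" where
  "online_algorithm A \<longleftrightarrow>
     (\<forall>I xs. \<forall>k\<le>length xs. feasible (instance_after I xs k) (solution_after A I xs k))"

definition competitive :: "real \<Rightarrow> algorithm \<Rightarrow> bool" where
  "competitive \<alpha> A \<longleftrightarrow>
     (\<forall>I xs. \<forall>k\<le>length xs.
        real (total_profit (instance_after I xs k) (solution_after A I xs k))
          \<ge> \<alpha> * real (opt (instance_after I xs k)))"

text \<open>Step \<open>j\<close> is the arrival of \<open>xs ! j\<close>, which gets the position \<open>length (items I) + j\<close>.\<close>

definition migration_cost :: "algorithm \<Rightarrow> knapsack \<Rightarrow> item list \<Rightarrow> nat \<Rightarrow> nat" where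
  "migration_cost A I xs j =
     total_weight (instance_after I xs (Suc j))
       (sym_diff (solution_after A I xs j) (solution_after A I xs (Suc j))
          - {length (items I) + j})"

definition migration_potential :: "item list \<Rightarrow> nat \<Rightarrow> nat" where
  "migration_potential xs j = weight (xs ! j)"

definition amortized_migration_bounded :: "real \<Rightarrow> algorithm \<Rightarrow> bool" where
  "amortized_migration_bounded B A \<longleftrightarrow>
     (\<forall>I xs. \<forall>k\<le>length xs.
        real (\<Sum>j<k. migration_cost A I xs j) \<le> B * real (\<Sum>j<k. migration_potential xs j))"

end

(* A knapsack filled by one heavy item of profit 1 has to hold that item at first. When an item of
   weight 1 and profit 2 arrives, a ratio above 1/2 forces the algorithm to pack it, and then the
   heavy item must leave. This single step has potential 1 but its cost is the capacity, which can
   be chosen larger than B. *)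
theory Submission
  imports Defs
begin

lemma feasible_le_opt: "feasible I S \<Longrightarrow> total_profit I S \<le> opt I"
  unfolding opt_def by (intro Max_ge finite_imageI finite_feasible) auto

text \<open>Any feasible \<open>T\<close> bounds \<open>opt\<close> from below, and multiplying by
  \<open>\<alpha> > 0\<close> preserves this. The ratio can thus be tested against one explicit
  packing, without computing the maximum in \<open>opt\<close>.\<close>

lemma online_competitive_profit:
  assumes "online_algorithm A" "competitive \<alpha> A" "\<alpha> > 0" "k \<le> length xs"
    and "feasible (instance_after I xs k) T"
  shows "feasible (instance_after I xs k) (solution_after A I xs k)"
    and "\<alpha> * real (total_profit (instance_after I xs k) T)
           \<le> real (total_profit (instance_after I xs k) (solution_after A I xs k))"
proof -
  show "feasible (instance_after I xs k) (solution_after A I xs k)"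
    using assms by (auto simp: online_algorithm_def)
  have "\<alpha> * real (total_profit (instance_after I xs k) T) \<le> \<alpha> * real (opt (instance_after I xs k))"
    using assms(3) feasible_le_opt[OF assms(5)] by (intro mult_left_mono) auto
  also have "\<dots> \<le> real (total_profit (instance_after I xs k) (solution_after A I xs k))"
    using assms(2,4) by (auto simp: competitive_def)
  finally show "\<alpha> * real (total_profit (instance_after I xs k) T)
      \<le> real (total_profit (instance_after I xs k) (solution_after A I xs k))" .
qed

theorem theorem18:
  fixes \<alpha> :: real
  assumes "\<alpha> > 1 / 2"
  shows "\<not> (\<exists>A B. online_algorithm A \<and> competitive \<alpha> A \<and> amortized_migration_bounded B A)"
proof
  assume "\<exists>A B. online_algorithm A \<and> competitive \<alpha> A \<and> amortized_migration_bounded B A"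
  then obtain A B where A: "online_algorithm A" "competitive \<alpha> A"
    and bounded: "amortized_migration_bounded B A"
    by blast
  \<comment> \<open>\<open>C > B\<close> makes evicting an item of weight \<open>C\<close> too
    expensive for a potential of 1. The maximum with 0 also forces \<open>C \<ge> 1\<close>, so that
    the arriving item of weight 1 fits on its own.\<close>
  obtain C :: nat where C: "real C > max B 0"
    using reals_Archimedean2 by blast
  define I where "I = \<lparr>capacity = C, items = [\<lparr>weight = C, profit = 1\<rparr>]\<rparr>"
  define xs where "xs = [\<lparr>weight = 1, profit = 2\<rparr> :: item]"
  define S0 where "S0 = solution_after A I xs 0"
  define S1 where "S1 = solution_after A I xs (Suc 0)"
  have \<alpha>: "\<alpha> > 0" using assms by simp
  have len: "0 \<le> length xs" "Suc 0 \<le> length xs" by (simp_all add: xs_def)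
  have I0: "instance_after I xs 0 = \<lparr>capacity = C, items = [\<lparr>weight = C, profit = 1\<rparr>]\<rparr>"
    by (simp add: instance_after_def I_def)
  have I1: "instance_after I xs (Suc 0)
      = \<lparr>capacity = C, items = [\<lparr>weight = C, profit = 1\<rparr>, \<lparr>weight = 1, profit = 2\<rparr>]\<rparr>"
    by (simp add: instance_after_def I_def xs_def)

  have "feasible (instance_after I xs 0) {0}"
    by (simp add: I0 feasible_def total_weight_def)
  note S0 = online_competitive_profit[OF A \<alpha> len(1) this, folded S0_def]
  have "S0 \<subseteq> {0}"
    using S0(1) by (auto simp: I0 feasible_def)
  \<comment> \<open>The empty packing has profit 0, but comparison with \<open>{0}\<close> demands
    at least \<open>\<alpha> > 0\<close>.\<close>
  moreover have "S0 \<noteq> {}"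
    using S0(2) \<alpha> by (auto simp: I0 total_profit_def)
  ultimately have S0_eq: "S0 = {0}" by blast

  have "feasible (instance_after I xs (Suc 0)) {1}"
    using C by (simp add: I1 feasible_def total_weight_def)
  note S1 = online_competitive_profit[OF A \<alpha> len(2) this, folded S1_def]
  have "{..<2} = {0, 1 :: nat}" by auto
  then have "S1 \<subseteq> {0, 1}"
    using S1(1) by (simp add: I1 feasible_def numeral_2_eq_2)
  then consider "S1 = {}" | "S1 = {0}" | "S1 = {1}" | "S1 = {0, 1}"
    by blast
  \<comment> \<open>Comparison with \<open>{1}\<close> demands profit at least
    \<open>2 * \<alpha> > 1\<close>, which excludes \<open>{}\<close> and \<open>{0}\<close>; the
    set \<open>{0, 1}\<close> weighs \<open>C + 1\<close> and exceeds the capacity.\<close>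
  then have S1_eq: "S1 = {1}"
    using S1 assms by cases (auto simp: I1 feasible_def total_weight_def total_profit_def)

  \<comment> \<open>The two solutions differ in both positions, but position 1 is the new item and
    is not charged; what remains is the heavy item.\<close>
  have "sym_diff S0 S1 - {length (items I) + 0} = {0}"
    by (auto simp: S0_eq S1_eq I_def)
  then have "migration_cost A I xs 0 = C"
    using I1 by (simp add: migration_cost_def S0_def S1_def total_weight_def)
  moreover have "migration_potential xs 0 = 1"
    by (simp add: migration_potential_def xs_def)
  moreover have "real (\<Sum>j<Suc 0. migration_cost A I xs j) \<le> B * real (\<Sum>j<Suc 0. migration_potential xs j)"
    using bounded len(2) unfolding amortized_migration_bounded_def by blast
  ultimately have "real C \<le> B" by simp
  with C show False by simp
qed

end
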